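(* Given the attacker's relative mining rate $\beta>0$, the number $N\ge1$ of required confirmations, and the attacker's give-up strategy $N_g$ (a positive integer), the probability $\mathsf{S}(N,\beta,N_g)$ of a successful alternative history attack (defined in the context) is $$\mathsf{S}(N,\beta,N_g)=\begin{cases}1-\displaystyle\sum_{n=0}^{N}\binom{n+N-1}{n}\left(\frac{1}{1+\beta}\right)^{N}\left(\frac{\beta}{1+\beta}\right)^{n}\left(\frac{1-\beta^{N-n+1}}{1-\beta^{N_g+1}}\right) & \text{if }\beta\neq1,\\[2ex] 1-\displaystyle\sum_{n=0}^{N}\frac{1}{2^{N+n}}\binom{n+N-1}{n}\left(\frac{N-n+1}{N_g+1}\right) & \text{if }\beta=1.\end{cases}$$
   Context: Alternative history attack model. Honest miners generate blocks on the benign chain according to a Poisson process of rate $\lambda^b>0$, and the attacker independently generates blocks on a secret fraudulent fork according to a Poisson process of rate $\beta\lambda^b$. Equivalently, the successive blocks form a sequence of independent trials, each block being honest with probability $\frac{1}{1+\beta}$ and the attacker's with probability $\frac{\beta}{1+\beta}$. Both forks start with length $0$ at the beginning of the attack. Phase 1 (waiting): the attacker mines secretly until the benign chain has grown by exactly $N$ blocks; let $Y$ be the number of blocks the attacker has generated by that time. Phase 2 (race): starting from the moment the benign chain reaches $N$ blocks, let the deficit be (length of the benign chain) $-$ (length of the fraudulent fork), so the initial deficit is $N-Y$. The deficit decreases by $1$ with each attacker block and increases by $1$ with each honest block. The attack succeeds as soon as the fraudulent fork is strictly longer than the benign chain, i.e. the deficit is negative (immediately, if $N-Y<0$). The attacker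 gives up, and the attack fails, if the fraudulent fork is $N_g$ blocks behind the benign chain (a race with deficit $\ge N_g$ is lost); $N_g$ is typically greater than $N$. $\mathsf{S}(N,\beta,N_g)$ denotes the probability that the attack succeeds, i.e. that the attacker wins the race of Phase 2 before giving up.
   Formalization: The formal theorem assumes N ≤ N_g; for every N_g < N the stated formula is false (e.g. N=2, N_g=1, β=1 gives 9/32, while immediate success alone has probability 10/32). *)

theory Defs
  imports "HOL-Probability.Probability"
begin

text \<open>
  The blocks mined after the start of the attack, in order of their generation, form a sequence of
  independent trials: the \<open>k\<close>-th entry of a stream is \<open>True\<close> if the \<open>k\<close>-th block is the attacker's
  and \<open>False\<close> if it is honest. For \<open>\<beta> > 0\<close> the attacker's probability \<open>\<beta> / (1 + \<beta>)\<close> lies strictly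
  between 0 and 1, so the truncation built into \<^const>\<open>bernoulli_pmf\<close> plays no role.
\<close>

definition block_sequence :: "real \<Rightarrow> bool stream measure" where
  "block_sequence \<beta> = stream_space (measure_pmf (bernoulli_pmf (\<beta> / (1 + \<beta>))))"

definition benign_length :: "bool stream \<Rightarrow> nat \<Rightarrow> nat" where
  "benign_length \<omega> k = card {i. i < k \<and> \<not> \<omega> !! i}"

definition fraud_length :: "bool stream \<Rightarrow> nat \<Rightarrow> nat" where
  "fraud_length \<omega> k = card {i. i < k \<and> \<omega> !! i}"

definition deficit :: "bool stream \<Rightarrow> nat \<Rightarrow> int" where
  "deficit \<omega> k = int (benign_length \<omega> k) - int (fraud_length \<omega> k)"

text \<open>
  Phase 1 ends after \<open>t\<close> blocks if this is the first time the benign chain has length \<open>N\<close>. The number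
  \<open>Y\<close> of attacker blocks generated by then is \<open>fraud_length \<omega> t\<close>, and \<open>deficit \<omega> t = N - Y\<close>.
  Such a \<open>t\<close> is unique if it exists, which is almost surely the case.
\<close>

definition waiting_ends :: "nat \<Rightarrow> bool stream \<Rightarrow> nat \<Rightarrow> bool" where
  "waiting_ends N \<omega> t \<longleftrightarrow> benign_length \<omega> t = N \<and> (\<forall>s<t. benign_length \<omega> s < N)"

text \<open>
  The race from time \<open>t\<close> is won if the deficit becomes negative at some time \<open>m\<close> before the attacker
  has given up; \<open>m = t\<close> is the immediate success. If \<open>deficit \<omega> t \<ge> Ng\<close>, then the race is lost.
\<close>

definition race_won :: "nat \<Rightarrow> bool stream \<Rightarrow> nat \<Rightarrow> bool" where
  "race_won Ng \<omega> t \<longleftrightarrow>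
     (\<exists>m\<ge>t. deficit \<omega> m < 0 \<and> (\<forall>k. t \<le> k \<and> k < m \<longrightarrow> deficit \<omega> k < int Ng))"

definition attack_succeeds :: "nat \<Rightarrow> nat \<Rightarrow> bool stream \<Rightarrow> bool" where
  "attack_succeeds N Ng \<omega> \<longleftrightarrow> (\<exists>t. waiting_ends N \<omega> t \<and> race_won Ng \<omega> t)"

definition success_prob :: "nat \<Rightarrow> real \<Rightarrow> nat \<Rightarrow> real" where
  "success_prob N \<beta> Ng =
     measure (block_sequence \<beta>) {\<omega> \<in> space (block_sequence \<beta>). attack_succeeds N Ng \<omega>}"

text \<open>
  In particular, \<^const>\<open>success_prob\<close> is the probability of an event, not the default value that
  \<^const>\<open>measure\<close> assigns to a non-measurable set.
\<close>

lemma attack_succeeds_sets: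
  "{\<omega> \<in> space (block_sequence \<beta>). attack_succeeds N Ng \<omega>} \<in> sets (block_sequence \<beta>)"
proof -
  define M where "M = measure_pmf (bernoulli_pmf (\<beta> / (1 + \<beta>)))"
  have "stream_space M \<rightarrow>\<^sub>M M = stream_space M \<rightarrow>\<^sub>M count_space UNIV"
    by (rule measurable_cong_sets) (simp_all add: M_def)
  then have nth [measurable]: "(\<lambda>\<omega>. \<omega> !! i) \<in> stream_space M \<rightarrow>\<^sub>M count_space UNIV" for i
    using measurable_snth[of i M] by blast
  have b: "benign_length \<omega> k = (\<Sum>i<k. if \<omega> !! i then 0 else 1)" for \<omega> k
    by (auto simp: benign_length_def sum.If_cases intro!: arg_cong[where f = card])
  have f: "fraud_length \<omega> k = (\<Sum>i<k. if \<omega> !! i then 1 else 0)" for \<omega> k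
    by (auto simp: fraud_length_def sum.If_cases intro!: arg_cong[where f = card])
  have [measurable]: "(\<lambda>\<omega>. benign_length \<omega> k) \<in> stream_space M \<rightarrow>\<^sub>M count_space UNIV" for k
    unfolding b by (induction k) (auto intro!: measurable_If nth)
  have [measurable]: "(\<lambda>\<omega>. fraud_length \<omega> k) \<in> stream_space M \<rightarrow>\<^sub>M count_space UNIV" for k
    unfolding f by (induction k) (auto intro!: measurable_If nth)
  have [measurable]: "(\<lambda>\<omega>. deficit \<omega> k) \<in> stream_space M \<rightarrow>\<^sub>M count_space UNIV" for k
    unfolding deficit_def by measurable
  show ?thesis
    unfolding block_sequence_def attack_succeeds_def waiting_ends_def race_won_def
    unfolding M_def [symmetric] by measurable
qed

end

theory Submission
  imports Defs
begin

text \<open>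
  First-step analysis on the first block. The success probability from a state with \<open>n\<close> honest blocks
  still to wait for and current deficit \<open>d\<close> satisfies a linear recurrence. In the race (\<open>n = 0\<close>) the
  failure probability is harmonic on the deficits from \<open>0\<close> to \<open>Ng - 1\<close>, so its increments form a
  geometric progression with ratio \<open>\<beta>\<close>, and the boundary values \<open>0\<close> at \<open>-1\<close> and \<open>1\<close> at \<open>Ng\<close> determine
  it. During the waiting phase \<open>e = d + n\<close> is the deficit that the race would start with if the attacker
  found no further block; an honest block keeps \<open>e\<close> and an attacker's block decreases it by one, so
  Pascal's rule gives the negative binomial weights by induction on \<open>e\<close> and \<open>n\<close>.
\<close>

text \<open>The start deficit is a constant offset \<open>d\<close> to the deficit of the stream, so
  the situation after one block is again an instance, evaluated on the tail.\<close>

definition attack_from :: "nat \<Rightarrow> nat \<Rightarrow> int \<Rightarrow> bool stream \<Rightarrow> bool" where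
  "attack_from Ng n d \<omega> \<longleftrightarrow>
     (\<exists>t. waiting_ends n \<omega> t \<and>
       (\<exists>m\<ge>t. d + deficit \<omega> m < 0 \<and> (\<forall>k. t \<le> k \<and> k < m \<longrightarrow> d + deficit \<omega> k < int Ng)))"

lemma attack_succeeds_eq_attack_from: "attack_succeeds N Ng = attack_from Ng N 0"
  by (simp add: fun_eq_iff attack_succeeds_def attack_from_def race_won_def)

section \<open>Effect of the first block on the chains and on the attack\<close>

lemma card_less_Suc_shift:
  "card {i. i < Suc k \<and> P i} = (if P 0 then 1 else 0) + card {i. i < k \<and> P (Suc i)}"
proof -
  have "{i. i < Suc k \<and> P i} = (if P 0 then {0} else {}) \<union> Suc ` {i. i < k \<and> P (Suc i)}"
    by (auto simp: image_iff less_Suc_eq_0_disj)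
  then show ?thesis
    by (simp add: card_image)
qed

lemma benign_length_0 [simp]: "benign_length \<omega> 0 = 0"
  by (simp add: benign_length_def)

lemma fraud_length_0 [simp]: "fraud_length \<omega> 0 = 0"
  by (simp add: fraud_length_def)

lemma deficit_0 [simp]: "deficit \<omega> 0 = 0"
  by (simp add: deficit_def)

lemma benign_length_Cons [simp]:
  "benign_length (b ## \<omega>) (Suc k) = (if b then 0 else 1) + benign_length \<omega> k"
  by (simp add: benign_length_def card_less_Suc_shift)

lemma fraud_length_Cons [simp]:
  "fraud_length (b ## \<omega>) (Suc k) = (if b then 1 else 0) + fraud_length \<omega> k"
  by (simp add: fraud_length_def card_less_Suc_shift)

lemma deficit_Cons [simp]:
  "deficit (b ## \<omega>) (Suc k) = (if b then -1 else 1) + deficit \<omega> k"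
  by (simp add: deficit_def)

lemma waiting_ends_0 [simp]: "waiting_ends 0 \<omega> t \<longleftrightarrow> t = 0"
  by (auto simp: waiting_ends_def)

lemma not_waiting_ends_Suc_0 [simp]: "\<not> waiting_ends (Suc n) \<omega> 0"
  by (simp add: waiting_ends_def)

lemma waiting_ends_Cons [simp]:
  "waiting_ends (Suc n) (b ## \<omega>) (Suc t) \<longleftrightarrow> waiting_ends (if b then Suc n else n) \<omega> t"
  by (auto simp: waiting_ends_def All_less_Suc2)

lemma waiting_ends_Ex_Cons:
  "(\<exists>t. waiting_ends (Suc n) (b ## \<omega>) t) \<longleftrightarrow> (\<exists>t. waiting_ends (if b then Suc n else n) \<omega> t)"
  by (metis not0_implies_Suc not_waiting_ends_Suc_0 waiting_ends_Cons)

lemma ex_nat_split: "(\<exists>n::nat. P n) \<longleftrightarrow> P 0 \<or> (\<exists>n. P (Suc n))"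
  by (metis not0_implies_Suc)

lemma ex_nat_ge_Suc: "(\<exists>m\<ge>Suc t. P m) \<longleftrightarrow> (\<exists>m\<ge>t. P (Suc m))"
  by (metis Suc_le_D Suc_le_mono)

lemma all_nat_between_Suc:
  "(\<forall>k. Suc t \<le> k \<and> k < Suc m \<longrightarrow> P k) \<longleftrightarrow> (\<forall>k. t \<le> k \<and> k < m \<longrightarrow> P (Suc k))"
  by (metis Suc_le_D Suc_le_mono Suc_less_eq)

text \<open>With an honest block still missing, the waiting cannot end at time 0, so all times in
  the definition shift by one.\<close>

lemma attack_from_Suc_Cons:
  "attack_from Ng (Suc n) d (b ## \<omega>) \<longleftrightarrow>
     (if b then attack_from Ng (Suc n) (d - 1) \<omega> else attack_from Ng n (d + 1) \<omega>)"
proof -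
  have "attack_from Ng (Suc n) d (b ## \<omega>) \<longleftrightarrow>
    (\<exists>t. waiting_ends (Suc n) (b ## \<omega>) (Suc t) \<and>
      (\<exists>m\<ge>Suc t. d + deficit (b ## \<omega>) m < 0 \<and>
        (\<forall>k. Suc t \<le> k \<and> k < m \<longrightarrow> d + deficit (b ## \<omega>) k < int Ng)))"
    unfolding attack_from_def by (subst ex_nat_split) simp
  then show ?thesis
    unfolding ex_nat_ge_Suc all_nat_between_Suc
    by (simp add: attack_from_def algebra_simps)
qed

lemma attack_from_0_neg: "d < 0 \<Longrightarrow> attack_from Ng 0 d \<omega>"
  by (auto simp: attack_from_def intro!: exI[of _ 0])

lemma not_attack_from_0_ge: "d \<ge> int Ng \<Longrightarrow> \<not> attack_from Ng 0 d \<omega>"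
  by (force simp: attack_from_def)

text \<open>The bounds on \<open>d\<close> say that the race is undecided: it is neither won at time
  0 nor already given up.\<close>

lemma attack_from_0_Cons:
  assumes "0 \<le> d" "d < int Ng"
  shows "attack_from Ng 0 d (b ## \<omega>) \<longleftrightarrow> attack_from Ng 0 (if b then d - 1 else d + 1) \<omega>"
proof -
  have *: "attack_from Ng 0 d \<omega> \<longleftrightarrow>
    (\<exists>m. d + deficit \<omega> m < 0 \<and> (\<forall>k<m. d + deficit \<omega> k < int Ng))" for d \<omega>
    by (simp add: attack_from_def)
  show ?thesis
    using assms unfolding *
    by (subst ex_nat_split) (simp add: All_less_Suc2 algebra_simps)
qed

text \<open>At the end of the waiting the stream contributes at most \<open>n\<close> to the
  deficit, so the race is won at its starting time \<open>m = t\<close>, where the give-up condition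
  is vacuous.\<close>

lemma attack_from_if_waiting_ends:
  assumes "waiting_ends n \<omega> t" "d + int n < 0"
  shows "attack_from Ng n d \<omega>"
proof -
  have "d + deficit \<omega> t < 0"
    using assms by (simp add: waiting_ends_def deficit_def)
  then show ?thesis
    unfolding attack_from_def using assms(1) by (intro exI[of _ t]) auto
qed

section \<open>Measurability\<close>

lemma measurable_snth_block_sequence [measurable]:
  "(\<lambda>\<omega>. \<omega> !! i) \<in> block_sequence \<beta> \<rightarrow>\<^sub>M count_space UNIV"
proof -
  have "(\<lambda>\<omega>. \<omega> !! i) \<in> block_sequence \<beta> \<rightarrow>\<^sub>M measure_pmf (bernoulli_pmf (\<beta> / (1 + \<beta>)))"
    unfolding block_sequence_def by (rule measurable_snth)
  then show ?thesis by simp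
qed

lemma measurable_benign_length [measurable]:
  "(\<lambda>\<omega>. benign_length \<omega> k) \<in> block_sequence \<beta> \<rightarrow>\<^sub>M count_space UNIV"
proof -
  have b: "benign_length \<omega> k = (\<Sum>i<k. if \<omega> !! i then 0 else 1)" for \<omega> k
    by (auto simp: benign_length_def sum.If_cases intro!: arg_cong[where f = card])
  show ?thesis
    unfolding b by (induction k) (simp_all, measurable)
qed

lemma deficit_eq_benign_length: "deficit \<omega> k = 2 * int (benign_length \<omega> k) - int k"
proof (induction k arbitrary: \<omega>)
  case (Suc k)
  show ?case by (cases \<omega>) (simp add: Suc)
qed simp

lemma measurable_deficit [measurable]:
  "(\<lambda>\<omega>. deficit \<omega> k) \<in> block_sequence \<beta> \<rightarrow>\<^sub>M count_space UNIV"
  unfolding deficit_eq_benign_length by measurable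

lemma pred_waiting_ends [measurable]:
  "Measurable.pred (block_sequence \<beta>) (\<lambda>\<omega>. waiting_ends n \<omega> t)"
  unfolding waiting_ends_def by measurable

lemma pred_attack_from [measurable]:
  "Measurable.pred (block_sequence \<beta>) (\<lambda>\<omega>. attack_from Ng n d \<omega>)"
proof -
  have [measurable]: "Measurable.pred (block_sequence \<beta>) (\<lambda>\<omega>. d + deficit \<omega> m < c)" for m c
    by (rule measurable_compose[OF measurable_deficit]) simp
  show ?thesis
    unfolding attack_from_def
    by (intro pred_intros_countable pred_intros_logic pred_waiting_ends) simp_all
qed

lemma space_block_sequence [simp]: "space (block_sequence \<beta>) = UNIV"
  by (simp add: block_sequence_def space_stream_space)

lemma prob_space_block_sequence: "prob_space (block_sequence \<beta>)"
  unfolding block_sequence_def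
  by (intro prob_space.prob_space_stream_space measure_pmf.prob_space_axioms)

section \<open>Conditioning on the first block\<close>

lemma measure_block_sequence_first_block:
  assumes "\<beta> > 0" and [measurable]: "Measurable.pred (block_sequence \<beta>) P"
  shows "measure (block_sequence \<beta>) {\<omega>. P \<omega>} =
    \<beta> / (1 + \<beta>) * measure (block_sequence \<beta>) {\<omega>. P (True ## \<omega>)} +
    1 / (1 + \<beta>) * measure (block_sequence \<beta>) {\<omega>. P (False ## \<omega>)}"
proof -
  define p where "p = \<beta> / (1 + \<beta>)"
  have p: "0 \<le> p" "p \<le> 1" "1 - p = 1 / (1 + \<beta>)"
    using assms(1) by (auto simp: p_def field_simps)
  interpret prob_space "block_sequence \<beta>" by (rule prob_space_block_sequence)
  have "{\<omega> \<in> space (block_sequence \<beta>). P \<omega>} \<in> sets (block_sequence \<beta>)"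
    by measurable
  then have "emeasure (block_sequence \<beta>) {\<omega>. P \<omega>} =
    (\<integral>\<^sup>+b. emeasure (block_sequence \<beta>) {\<omega>. P (b ## \<omega>)} \<partial>measure_pmf (bernoulli_pmf p))"
    using prob_space.emeasure_stream_space
      [OF measure_pmf.prob_space_axioms, of "{\<omega>. P \<omega>}" "bernoulli_pmf p"]
    by (simp add: block_sequence_def p_def space_stream_space)
  also have "\<dots> = ennreal (p * prob {\<omega>. P (True ## \<omega>)} + (1 - p) * prob {\<omega>. P (False ## \<omega>)})"
    using p(1,2) by (simp add: emeasure_eq_measure ennreal_mult mult.commute)
  finally have "prob {\<omega>. P \<omega>} = p * prob {\<omega>. P (True ## \<omega>)} + (1 - p) * prob {\<omega>. P (False ## \<omega>)}"
    using p(1,2) unfolding emeasure_eq_measure by (subst (asm) ennreal_inj) auto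
  then show ?thesis
    by (simp only: p(3) p_def[symmetric])
qed

text \<open>An attacker's block leaves the same wait, an honest one a wait that ends almost surely
  by induction. The resulting equation for \<open>?V\<close> forces the value 1, because an honest
  block has positive probability.\<close>

lemma measure_waiting_ends:
  assumes "\<beta> > 0"
  shows "measure (block_sequence \<beta>) {\<omega>. \<exists>t. waiting_ends n \<omega> t} = 1"
proof (induction n)
  case 0
  show ?case
    using prob_space.prob_space[OF prob_space_block_sequence[of \<beta>]] by simp
next
  case (Suc n)
  let ?V = "measure (block_sequence \<beta>) {\<omega>. \<exists>t. waiting_ends (Suc n) \<omega> t}"
  have "?V = \<beta> / (1 + \<beta>) * ?V + 1 / (1 + \<beta>)"
    using measure_block_sequence_first_block[OF assms, of "\<lambda>\<omega>. \<exists>t. waiting_ends (Suc n) \<omega> t"] Suc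
    by (simp add: waiting_ends_Ex_Cons)
  then show ?case
    using assms by (simp add: field_simps)
qed

text \<open>Failure is more convenient than success because it vanishes when \<open>d + n\<close> is
  negative, which makes the sum over attacker blocks finite.\<close>

definition failure_prob :: "real \<Rightarrow> nat \<Rightarrow> nat \<Rightarrow> int \<Rightarrow> real" where
  "failure_prob \<beta> Ng n d = 1 - measure (block_sequence \<beta>) {\<omega>. attack_from Ng n d \<omega>}"

text \<open>Complements preserve the averaging since the two weights add up to 1. The successor
  states are parameters so that both phases are covered.\<close>

lemma failure_prob_first_block:
  assumes "\<beta> > 0"
    and "\<And>\<omega>. attack_from Ng n d (True ## \<omega>) \<longleftrightarrow> attack_from Ng n1 d1 \<omega>"
    and "\<And>\<omega>. attack_from Ng n d (False ## \<omega>) \<longleftrightarrow> attack_from Ng n2 d2 \<omega>"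
  shows "failure_prob \<beta> Ng n d =
    \<beta> / (1 + \<beta>) * failure_prob \<beta> Ng n1 d1 + 1 / (1 + \<beta>) * failure_prob \<beta> Ng n2 d2"
proof -
  have *: "\<beta> / (1 + \<beta>) + 1 / (1 + \<beta>) = 1"
    using assms(1) by (simp add: field_simps)
  have convex: "1 - (p * a + q * b) = p * (1 - a) + q * (1 - b)" if "p + q = 1" for p q a b :: real
    using that by algebra
  show ?thesis
    unfolding failure_prob_def convex[OF *, symmetric]
    by (subst measure_block_sequence_first_block[OF assms(1) pred_attack_from]) (simp only: assms(2,3))
qed

lemma failure_prob_Suc:
  assumes "\<beta> > 0"
  shows "failure_prob \<beta> Ng (Suc n) d =
    \<beta> / (1 + \<beta>) * failure_prob \<beta> Ng (Suc n) (d - 1) + 1 / (1 + \<beta>) * failure_prob \<beta> Ng n (d + 1)"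
  using assms by (rule failure_prob_first_block) (simp_all only: attack_from_Suc_Cons if_True if_False)

lemma failure_prob_0:
  assumes "\<beta> > 0" "0 \<le> d" "d < int Ng"
  shows "failure_prob \<beta> Ng 0 d =
    \<beta> / (1 + \<beta>) * failure_prob \<beta> Ng 0 (d - 1) + 1 / (1 + \<beta>) * failure_prob \<beta> Ng 0 (d + 1)"
  by (rule failure_prob_first_block) (simp_all only: assms attack_from_0_Cons if_True if_False)

text \<open>The attack can fail here only if the waiting never ends, which has probability
  0.\<close>

lemma failure_prob_neg:
  assumes "\<beta> > 0" "d + int n < 0"
  shows "failure_prob \<beta> Ng n d = 0"
proof -
  interpret prob_space "block_sequence \<beta>" by (rule prob_space_block_sequence)
  have "{\<omega> \<in> space (block_sequence \<beta>). attack_from Ng n d \<omega>} \<in> events"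
    by measurable
  then have "prob {\<omega>. \<exists>t. waiting_ends n \<omega> t} \<le> prob {\<omega>. attack_from Ng n d \<omega>}"
    using attack_from_if_waiting_ends[OF _ assms(2)] by (intro finite_measure_mono) auto
  then have "1 \<le> prob {\<omega>. attack_from Ng n d \<omega>}"
    unfolding measure_waiting_ends[OF assms(1)] .
  then show ?thesis
    unfolding failure_prob_def using prob_le_1 by (metis antisym diff_self)
qed

lemma failure_prob_0_ge: "d \<ge> int Ng \<Longrightarrow> failure_prob \<beta> Ng 0 d = 1"
  by (simp add: failure_prob_def not_attack_from_0_ge)

section \<open>The race as a gambler's ruin problem\<close>

lemma failure_prob_race:
  assumes "\<beta> > 0" "d \<le> Ng"
  shows "failure_prob \<beta> Ng 0 (int d) = (\<Sum>j\<le>d. \<beta> ^ j) / (\<Sum>j\<le>Ng. \<beta> ^ j)"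
proof -
  \<comment> \<open>The index is shifted by one so that \<open>u 0\<close> is the boundary value at
    deficit -1 and \<open>u (Suc Ng)\<close> the one at \<open>Ng\<close>.\<close>
  define u where "u i = failure_prob \<beta> Ng 0 (int i - 1)" for i
  have u0: "u 0 = 0"
    using assms(1) by (simp add: u_def failure_prob_neg)
  have step: "u (Suc (Suc i)) - u (Suc i) = \<beta> * (u (Suc i) - u i)" if "i < Ng" for i
  proof -
    have "u (Suc i) = (\<beta> * u i + u (Suc (Suc i))) / (1 + \<beta>)"
      using failure_prob_0[of \<beta> "int i" Ng] assms(1) that
      by (simp add: u_def add_divide_distrib add.commute)
    then show ?thesis
      using assms(1) by (simp add: field_simps)
  qed
  have incr: "u (Suc i) - u i = \<beta> ^ i * u 1" if "i \<le> Ng" for i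
    using that
  proof (induction i)
    case 0
    then show ?case by (simp add: u0)
  next
    case (Suc i)
    then show ?case using step[of i] by simp
  qed
  have u: "u (Suc i) = u 1 * (\<Sum>j\<le>i. \<beta> ^ j)" if "i \<le> Ng" for i
    using that
  proof (induction i)
    case 0
    then show ?case by simp
  next
    case (Suc i)
    then show ?case using incr[of "Suc i"] by (simp add: algebra_simps)
  qed
  have "u (Suc Ng) = 1"
    by (simp add: u_def failure_prob_0_ge)
  \<comment> \<open>A product equal to 1 has nonzero factors, so dividing by the geometric sum is
    legitimate.\<close>
  then have "u 1 = 1 / (\<Sum>j\<le>Ng. \<beta> ^ j)"
    using u[of Ng] by (metis le_refl mult_zero_right nonzero_eq_divide_eq zero_neq_one)
  then show ?thesis
    using u[OF assms(2)] by (simp add: u_def)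
qed

section \<open>The waiting phase\<close>

text \<open>Pascal's rule splits each term with positive \<open>k\<close>. The term
  \<open>k = 0\<close> goes entirely to the \<open>q\<close> part, where both binomial coefficients
  are 1 even if \<open>n - 1\<close> is truncated.\<close>

lemma negative_binomial_sum_Suc:
  fixes p q :: "'a :: comm_ring_1"
  shows "(\<Sum>k\<le>Suc e. of_nat ((k + n) choose k) * q ^ Suc n * p ^ k * h (Suc e - k)) =
    q * (\<Sum>k\<le>Suc e. of_nat ((k + n - 1) choose k) * q ^ n * p ^ k * h (Suc e - k)) +
    p * (\<Sum>k\<le>e. of_nat ((k + n) choose k) * q ^ Suc n * p ^ k * h (e - k))"
proof -
  have "of_nat ((Suc k + n) choose Suc k) =
      of_nat ((k + n) choose Suc k) + (of_nat ((k + n) choose k) :: 'a)" for k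
    by simp
  then show ?thesis
    by (simp add: sum.atMost_Suc_shift sum_distrib_left sum.distrib algebra_simps
          del: sum.atMost_Suc)
qed

lemma failure_prob_eq_sum:
  assumes "\<beta> > 0" "e \<le> Ng"
  shows "failure_prob \<beta> Ng n (int e - int n) =
    (\<Sum>k\<le>e. real ((k + n - 1) choose k) * (1 / (1 + \<beta>)) ^ n * (\<beta> / (1 + \<beta>)) ^ k *
      ((\<Sum>j\<le>e - k. \<beta> ^ j) / (\<Sum>j\<le>Ng. \<beta> ^ j)))"
  using assms(2)
\<comment> \<open>An attacker's block needs the outer hypothesis at \<open>Suc n\<close>, an honest
  block the inner one at the same \<open>e\<close>.\<close>
proof (induction e arbitrary: n)
  case 0
  show ?case
  proof (induction n)
    case 0
    then show ?case using failure_prob_race[OF assms(1), of 0 Ng] by simp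
  next
    case (Suc n)
    then show ?case
      \<comment> \<open>At \<open>e = 0\<close> an attacker's block makes success almost sure, so
        only the honest branch contributes.\<close>
      using failure_prob_Suc[OF assms(1), of Ng n "- 1 - int n"] assms(1)
      by (simp add: failure_prob_neg)
  qed
next
  case (Suc e)
  note IH = Suc.IH
  have e: "e \<le> Ng" using Suc.prems by simp
  show ?case
  proof (induction n)
    case 0
    show ?case
      \<comment> \<open>For \<open>n = 0\<close> the coefficient \<open>(k - 1) choose k\<close> is
        1 at \<open>k = 0\<close>, by truncated subtraction, and 0 otherwise.\<close>
      using failure_prob_race[OF assms(1) Suc.prems]
      by (simp add: sum.atMost_Suc_shift binomial_eq_0 del: sum.atMost_Suc)
  next
    case (Suc n)
    have "failure_prob \<beta> Ng (Suc n) (int (Suc e) - int (Suc n)) =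
      1 / (1 + \<beta>) * failure_prob \<beta> Ng n (int (Suc e) - int n) +
      \<beta> / (1 + \<beta>) * failure_prob \<beta> Ng (Suc n) (int e - int (Suc n))"
      using failure_prob_Suc[OF assms(1), of Ng n "int e - int n"] by (simp add: algebra_simps)
    then show ?case
      unfolding IH[OF e, of "Suc n"] Suc add_Suc_right diff_Suc_1
        negative_binomial_sum_Suc[where h = "\<lambda>i. (\<Sum>j\<le>i. \<beta> ^ j) / (\<Sum>j\<le>Ng. \<beta> ^ j)"] .
  qed
qed

theorem theorem2:
  fixes \<beta> :: real and N Ng :: nat
  assumes "\<beta> > 0" and "N \<ge> 1" and "Ng \<ge> 1" and "N \<le> Ng"
  shows "success_prob N \<beta> Ng =
    (if \<beta> \<noteq> 1 then
       1 - (\<Sum>n = 0..N. real ((n + N - 1) choose n) * (1 / (1 + \<beta>)) ^ N * (\<beta> / (1 + \<beta>)) ^ n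
              * ((1 - \<beta> ^ (N - n + 1)) / (1 - \<beta> ^ (Ng + 1))))
     else
       1 - (\<Sum>n = 0..N. 1 / 2 ^ (N + n) * real ((n + N - 1) choose n)
              * (real (N - n + 1) / real (Ng + 1))))"
proof -
  \<comment> \<open>The attack starts with deficit 0, which is the case
    \<open>e = n = N\<close>.\<close>
  have main: "success_prob N \<beta> Ng = 1 -
    (\<Sum>n\<le>N. real ((n + N - 1) choose n) * (1 / (1 + \<beta>)) ^ N * (\<beta> / (1 + \<beta>)) ^ n *
      ((\<Sum>j\<le>N - n. \<beta> ^ j) / (\<Sum>j\<le>Ng. \<beta> ^ j)))"
    using failure_prob_eq_sum[OF assms(1,4), of N]
    by (simp add: success_prob_def failure_prob_def attack_succeeds_eq_attack_from)
  show ?thesis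
  proof (cases "\<beta> = 1")
    case True
    have "1 / 2 ^ (N + n) = (1 / 2) ^ N * (1 / 2 :: real) ^ n" for n
      by (simp add: power_add power_one_over)
    then show ?thesis
      using main True by (simp add: atLeast0AtMost mult_ac add_ac)
  next
    case False
    \<comment> \<open>The factors \<open>1 - \<beta>\<close> of the two geometric sums
      cancel.\<close>
    then have "(\<Sum>j\<le>a. \<beta> ^ j) / (\<Sum>j\<le>b. \<beta> ^ j) = (1 - \<beta> ^ (a + 1)) / (1 - \<beta> ^ (b + 1))" for a b
      by (simp add: sum_gp0)
    then show ?thesis
      using main False by (simp add: atLeast0AtMost)
  qed
qed

end
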